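(* Let $f(u,\beta)=h(u)\,(A(\beta)-B(\beta)h'(u))$ be a monostable nonlinearity of solvable type, depending on a parameter $\beta\in\mathbb{R}$. Suppose there is a non-degenerate solution $\beta^*$ to the equation $A(\beta)=2B(\beta)$. Then if $$L:=\max_{u\in[0,1]}h'(u)=h'(0)=1,$$ there is a minimality exchange at $\beta=\beta^*$.
   Context: Let $\beta\in\mathbb{R}$ be a parameter. The nonlinearity $f(u,\beta)$ is monostable if (with $'$ on $f$ denoting the derivative in $u$) $f(0,\beta)=f(1,\beta)=0$, $f'(0,\beta)>0$, $f'(1,\beta)<0$ and $f(u,\beta)>0$ for $u\in(0,1)$. It is of solvable type if it can be written as $f(u,\beta)=h(u)\,(A(\beta)-B(\beta)h'(u))$, where $h$ is a function of $u$ alone with $h(0)=h(1)=0$, $h(u)\ge 0$ and (without loss of generality) $h'(0)=1$, and where $A(\beta)>0$, $B(\beta)>0$, and $A(\beta)-B(\beta)h'(u)>0$ for all $u\in[0,1]$. For $c\ge 0$, a monotone front of speed $c$ for $u_t=u_{xx}+f(u,\beta)$ is a monotone solution $U(z)$, $z=x-ct$, of $U''+cU'+f(U,\beta)=0$ with $\lim_{z\to-\infty}U(z)=1$ and $\lim_{z\to\infty}U(z)=0$. The linear speed is $c_l(\beta)=2\sqrt{f'(0,\beta)}=2\sqrt{A(\beta)-B(\beta)}$; there are no monotone fronts for $c<c_l(\beta)$. The minimal speed $c_{min}(\beta)\ge c_l(\beta)$ is the smallest number such that a monotone front of speed $c$ exists for all $c\ge c_{min}(\beta)$. The number $c_{nl}(\beta)=A(\beta)/\sqrt{B(\beta)}$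 is the speed of the explicit front determined by $-U'=\sqrt{B(\beta)}\,h(U)$. A solution $\beta^*$ of the equation $A(\beta)=2B(\beta)$ is non-degenerate if the graphs of the functions $A(\cdot)$ and $2B(\cdot)$ intersect transversely at $\beta^*$. There is a minimality exchange at $\beta^*$ if for values $\beta$ to one side of $\beta^*$ one has $c_{min}(\beta)=c_l(\beta)$, and for values of $\beta$ to the other side of $\beta^*$ one has $c_{min}(\beta)=c_{nl}(\beta)$, so that at $\beta^*$ minimality is exchanged between $c_l(\beta)$ and $c_{nl}(\beta)$. *)

theory Defs
  imports "HOL-Analysis.Analysis"
begin

text \<open>The variable \<open>u\<close> ranges over the closed unit interval, so all derivatives in \<open>u\<close> are taken
  within it (they are one-sided at 0 and 1), and values outside it are irrelevant.\<close>

abbreviation unit_deriv :: "(real \<Rightarrow> real) \<Rightarrow> real \<Rightarrow> real" where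
  "unit_deriv g u \<equiv> vector_derivative g (at u within {0..1})"

definition monostable :: "(real \<Rightarrow> real) \<Rightarrow> bool" where
  "monostable g \<longleftrightarrow>
     g 0 = 0 \<and> g 1 = 0 \<and>
     g differentiable (at 0 within {0..1}) \<and> unit_deriv g 0 > 0 \<and>
     g differentiable (at 1 within {0..1}) \<and> unit_deriv g 1 < 0 \<and>
     (\<forall>u\<in>{0<..<1}. g u > 0)"

text \<open>The regularity understood for \<open>h\<close> is continuous differentiability on the closed interval,
  which makes each nonlinearity continuous.\<close>

definition solvable_type ::
  "(real \<Rightarrow> real \<Rightarrow> real) \<Rightarrow> (real \<Rightarrow> real) \<Rightarrow> (real \<Rightarrow> real) \<Rightarrow> (real \<Rightarrow> real) \<Rightarrow> bool" where
  "solvable_type f h A B \<longleftrightarrow>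
     h differentiable_on {0..1} \<and> continuous_on {0..1} (unit_deriv h) \<and>
     h 0 = 0 \<and> h 1 = 0 \<and> (\<forall>u\<in>{0..1}. h u \<ge> 0) \<and> unit_deriv h 0 = 1 \<and>
     (\<forall>\<beta>. A \<beta> > 0 \<and> B \<beta> > 0) \<and>
     (\<forall>\<beta>. \<forall>u\<in>{0..1}. A \<beta> - B \<beta> * unit_deriv h u > 0) \<and>
     (\<forall>\<beta>. \<forall>u\<in>{0..1}. f u \<beta> = h u * (A \<beta> - B \<beta> * unit_deriv h u))"

text \<open>Monotonicity and the two limits force \<open>U\<close> to be nonincreasing with values in the unit
  interval.\<close>

definition monotone_front :: "(real \<Rightarrow> real) \<Rightarrow> real \<Rightarrow> (real \<Rightarrow> real) \<Rightarrow> bool" where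
  "monotone_front g c U \<longleftrightarrow>
     (\<exists>U' U''. \<forall>z. (U has_real_derivative U' z) (at z) \<and>
                    (U' has_real_derivative U'' z) (at z) \<and>
                    U'' z + c * U' z + g (U z) = 0) \<and>
     (mono U \<or> antimono U) \<and>
     (U \<longlongrightarrow> 1) at_bot \<and> (U \<longlongrightarrow> 0) at_top"

text \<open>A relation rather than a function: it asserts that the smallest such speed exists.\<close>

definition is_minimal_speed :: "(real \<Rightarrow> real) \<Rightarrow> real \<Rightarrow> bool" where
  "is_minimal_speed g m \<longleftrightarrow>
     (let S = {s. 0 \<le> s \<and> (\<forall>c\<ge>s. \<exists>U. monotone_front g c U)}
      in m \<in> S \<and> (\<forall>s\<in>S. m \<le> s))"

definition linear_speed :: "(real \<Rightarrow> real) \<Rightarrow> real" where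
  "linear_speed g = 2 * sqrt (unit_deriv g 0)"

definition nonlinear_speed :: "(real \<Rightarrow> real) \<Rightarrow> (real \<Rightarrow> real) \<Rightarrow> real \<Rightarrow> real" where
  "nonlinear_speed A B \<beta> = A \<beta> / sqrt (B \<beta>)"

text \<open>Graphs of functions that are differentiable at a common point meet transversely there iff
  their tangent lines have different slopes.\<close>

definition graphs_transverse_at :: "(real \<Rightarrow> real) \<Rightarrow> (real \<Rightarrow> real) \<Rightarrow> real \<Rightarrow> bool" where
  "graphs_transverse_at F G x \<longleftrightarrow>
     F x = G x \<and>
     (\<exists>a b. (F has_real_derivative a) (at x) \<and> (G has_real_derivative b) (at x) \<and> a \<noteq> b)"

definition nondegenerate_solution :: "(real \<Rightarrow> real) \<Rightarrow> (real \<Rightarrow> real) \<Rightarrow> real \<Rightarrow> bool" where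
  "nondegenerate_solution A B \<beta> \<longleftrightarrow>
     A \<beta> = 2 * B \<beta> \<and> graphs_transverse_at A (\<lambda>b. 2 * B b) \<beta>"

text \<open>The two sides of \<open>\<beta>s\<close> are one-sided neighbourhoods: the equation \<open>A \<beta> = 2 * B \<beta>\<close> may have
  further solutions, at which the roles of the two speeds can change again.\<close>

definition minimality_exchange ::
  "(real \<Rightarrow> real \<Rightarrow> real) \<Rightarrow> (real \<Rightarrow> real) \<Rightarrow> (real \<Rightarrow> real) \<Rightarrow> real \<Rightarrow> bool" where
  "minimality_exchange f A B \<beta>s \<longleftrightarrow>
     (let lin = (\<lambda>\<beta>. is_minimal_speed (\<lambda>u. f u \<beta>) (linear_speed (\<lambda>u. f u \<beta>)));
          nonlin = (\<lambda>\<beta>. is_minimal_speed (\<lambda>u. f u \<beta>) (nonlinear_speed A B \<beta>))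
      in (eventually lin (at_left \<beta>s) \<and> eventually nonlin (at_right \<beta>s)) \<or>
         (eventually nonlin (at_left \<beta>s) \<and> eventually lin (at_right \<beta>s)))"

end

theory Submission
  imports Defs
begin

text \<open>In the phase plane of \<open>U'' + c * U' + f U = 0\<close>, write a decreasing front as \<open>- U' = R * h U\<close>. A constant
\<open>R = k\<close> is an upper barrier for such trajectories if \<open>(k\<^sup>2 - B) * h' + A - c * k \<le> 0\<close> on \<open>[0, 1]\<close>, and
then a front of speed \<open>c\<close> with \<open>R \<le> k\<close> exists (\<open>front_exists\<close>). For \<open>k = sqrt B\<close> the condition is
\<open>c \<ge> A / sqrt B\<close>. For \<open>k = sqrt (A - B)\<close>, if \<open>A \<ge> 2 * B\<close>, the bound \<open>h' \<le> 1\<close> reduces it to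
\<open>c \<ge> 2 * sqrt (A - B)\<close>.

Conversely, as \<open>U\<close> tends to 0 the ratio \<open>R\<close> follows approximately the equation \<open>R' = P R\<close> with the
characteristic polynomial \<open>P r = r\<^sup>2 - c * r + (A - B)\<close>, and it remains bounded. So there is no front if
\<open>P\<close> is bounded below by a positive constant on the values taken by \<open>R\<close> (\<open>no_front_above_slope\<close>). Below
the linear speed \<open>P\<close> is positive throughout. Below the nonlinear speed, comparison with the explicit
front \<open>- U' = sqrt B * h U\<close> forces \<open>R \<ge> sqrt B\<close>, and for \<open>A < 2 * B\<close> the polynomial \<open>P\<close> is positive on
that half-line.

Thus the linear speed is minimal where \<open>A \<ge> 2 * B\<close> and the nonlinear speed where \<open>A < 2 * B\<close>
(\<open>linear_speed_minimal\<close>, \<open>nonlinear_speed_minimal\<close>). At a non-degenerate solution the difference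
\<open>A - 2 * B\<close> has a nonzero derivative, so it changes sign and minimality passes from one speed to the
other.\<close>

section \<open>Ordinary differential equations on the whole line\<close>

lemma tail_integral_split:
  fixes f :: "real \<Rightarrow> real"
  assumes "\<And>x. f integrable_on {x..}" and "a \<le> x"
  shows "integral {a..} f = integral {a..x} f + integral {x..} f"
proof -
  have "f integrable_on {a..x}"
    using integrable_on_subinterval[OF assms(1)[of a], of a x] by auto
  then have "(f has_integral integral {a..x} f + integral {x..} f) ({a..x} \<union> {x..})"
    by (intro has_integral_Un integrable_integral assms) (auto simp: assms(2) Int_absorb2 intro: negligible_subset[of "{x}"])
  moreover have "{a..x} \<union> {x..} = {a..}" using assms(2) by auto
  ultimately show ?thesis by (metis integral_unique)
qed

lemma continuous_tail_integral:
  fixes f :: "real \<Rightarrow> real"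
  assumes "\<And>x. f integrable_on {x..}"
  shows "continuous_on UNIV (\<lambda>x. integral {x..} f)"
proof -
  have "isCont (\<lambda>x. integral {x..} f) x" for x
  proof -
    have "f integrable_on {x-1..x+1}"
      using integrable_on_subinterval[OF assms(1)[of "x-1"], of "x-1" "x+1"] by auto
    then have "continuous_on {x-1..x+1} (\<lambda>y. integral {x-1..} f - integral {x-1..y} f)"
      by (intro continuous_intros indefinite_integral_continuous_1)
    then have "continuous_on {x-1..x+1} (\<lambda>y. integral {y..} f)"
      by (rule continuous_on_eq) (use tail_integral_split[OF assms] in force)
    then show ?thesis
      by (rule continuous_on_interior) auto
  qed
  then show ?thesis by (simp add: continuous_at_imp_continuous_on)
qed

lemma tail_integral_has_derivative:
  fixes f :: "real \<Rightarrow> real"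
  assumes "\<And>x. f integrable_on {x..}" and "continuous_on UNIV f"
  shows "((\<lambda>x. integral {x..} f) has_real_derivative - f x) (at x)"
proof -
  have "((\<lambda>y. integral {x-1..y} f) has_real_derivative f x) (at x within {x-1..x+1})"
    by (rule integral_has_real_derivative) (use assms(2) continuous_on_subset in auto)
  then have "((\<lambda>y. integral {x-1..} f - integral {x-1..y} f) has_real_derivative - f x)
      (at x within {x-1..x+1})"
    by (auto intro!: derivative_eq_intros)
  then have "((\<lambda>y. integral {y..} f) has_real_derivative - f x) (at x within {x-1..x+1})"
    by (rule has_field_derivative_transform_within[where d = 1])
       (use tail_integral_split[OF assms(1), of "x-1"] in auto)
  moreover have "at x within {x-1..x+1} = at x"
    by (rule at_within_interior) auto
  ultimately show ?thesis by simp
qed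

lemma exp_weight_integrable:
  fixes f :: "real \<Rightarrow> real"
  assumes "K > 0" "continuous_on UNIV f" "\<And>t. \<bar>f t\<bar> \<le> C"
  shows "(\<lambda>t. exp (-K*t) * f t) integrable_on {x..}"
proof (rule measurable_bounded_by_integrable_imp_integrable)
  show "(\<lambda>t. exp (-K*t) * f t) \<in> borel_measurable (lebesgue_on {x..})"
    by (intro continuous_imp_measurable_on_sets_lebesgue continuous_intros)
       (use assms(2) continuous_on_subset in auto)
  show "(\<lambda>t. C * exp (-K*t)) integrable_on {x..}"
    using integrable_on_exp_minus_to_infinity[OF assms(1)] by (intro integrable_on_mult_right)
  show "norm (exp (-K*t) * f t) \<le> C * exp (-K*t)" for t
    using mult_right_mono[OF assms(3)[of t], of "exp (-K*t)"] by (simp add: abs_mult mult.commute)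
qed auto

text \<open>A scalar equation whose constants \<open>\<delta>\<close> and \<open>k\<close> are a lower and an upper barrier, for \<open>x\<close>
running backwards, has a solution on the whole line that stays between them. The bound \<open>lip\<close> makes
\<open>H x y = K * y - \<Phi> x y\<close> nondecreasing in \<open>y\<close>, and a function with values in \<open>{\<delta>..k}\<close> solves \<open>y' = K * y - H x y\<close> iff it is a fixed point of
\<open>T y x = exp (K * x) * integral {x..} (\<lambda>t. exp (- K * t) * H t (y t))\<close>. This operator is
order-preserving and, by the two barrier conditions, maps functions with values in \<open>{\<delta>..k}\<close> to such
functions, so its iterates started at the constant \<open>k\<close> decrease to a fixed point. Integrating over
a half-line, instead of from an initial point, yields a solution on the whole line at once.\<close>

lemma entire_solution_between_constants:
  fixes \<Phi> :: "real \<Rightarrow> real \<Rightarrow> real"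
  assumes K: "K > 0" and lower: "0 < \<delta>" and ord: "\<delta> \<le> k"
    and cont: "continuous_on (UNIV \<times> {\<delta>..k}) (\<lambda>(x, y). \<Phi> x y)"
    and sub: "\<And>x. \<Phi> x \<delta> \<le> 0" and super: "\<And>x. 0 \<le> \<Phi> x k"
    and lip: "\<And>x y1 y2. \<delta> \<le> y1 \<Longrightarrow> y1 \<le> y2 \<Longrightarrow> y2 \<le> k \<Longrightarrow> \<Phi> x y2 - \<Phi> x y1 \<le> K * (y2 - y1)"
  obtains y where "\<And>x. y x \<in> {\<delta>..k}" "\<And>x. (y has_real_derivative \<Phi> x (y x)) (at x)"
proof -
  define H where "H = (\<lambda>x y. K * y - \<Phi> x y)"
  have Hmono: "H x y1 \<le> H x y2" if "\<delta> \<le> y1" "y1 \<le> y2" "y2 \<le> k" for x y1 y2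
    using lip[OF that, of x] by (simp add: H_def algebra_simps)
  have Hlow: "K * \<delta> \<le> H x y" and Hup: "H x y \<le> K * k" if "y \<in> {\<delta>..k}" for x y
    using Hmono[of \<delta> y x] Hmono[of y k x] that sub[of x] super[of x] by (auto simp: H_def)
  have Habs: "\<bar>H x y\<bar> \<le> K * k" if "y \<in> {\<delta>..k}" for x y
    using Hlow[OF that, of x] Hup[OF that, of x] mult_pos_pos[OF K lower] by linarith
  have Hcont: "continuous_on (UNIV \<times> {\<delta>..k}) (\<lambda>(x, y). H x y)"
  proof -
    have "continuous_on (UNIV \<times> {\<delta>..k}) (\<lambda>z. K * snd z - (\<lambda>(x, y). \<Phi> x y) z)"
      by (intro continuous_intros cont)
    then show ?thesis by (simp add: H_def case_prod_unfold)
  qed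
  have HcontI: "continuous_on UNIV (\<lambda>x. H x (y x))"
    if "continuous_on UNIV y" "\<And>x. y x \<in> {\<delta>..k}" for y
    using continuous_on_compose2[OF Hcont, of UNIV "\<lambda>x. (x, y x)"] that
      continuous_on_Pair[OF continuous_on_id that(1)] by (simp add: image_subset_iff id_def)
  define w where "w = (\<lambda>y t. exp (-K*t) * H t (y t))"
  define T where "T = (\<lambda>y x. exp (K*x) * integral {x..} (w y))"
  have bound_has_int: "((\<lambda>t. exp (-K*t) * (K * a)) has_integral exp (-K*x) * a) {x..}" for a x
    using has_integral_mult_left[OF has_integral_exp_minus_to_infinity[OF K, of x], of "K * a"] K
    by simp
  note bound_int = integral_unique[OF bound_has_int] and bound_intble = has_integral_integrable[OF bound_has_int]
  have range: "T y x \<in> {\<delta>..k}"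
    if "w y integrable_on {x..}" "\<And>t. y t \<in> {\<delta>..k}" for y :: "real \<Rightarrow> real" and x
  proof -
    have "integral {x..} (\<lambda>t. exp (-K*t) * (K * \<delta>)) \<le> integral {x..} (w y)"
      by (intro integral_le bound_intble that) (simp add: w_def Hlow[OF that(2)])
    moreover have "integral {x..} (w y) \<le> integral {x..} (\<lambda>t. exp (-K*t) * (K * k))"
      by (intro integral_le bound_intble that) (simp add: w_def Hup[OF that(2)])
    ultimately have "exp (K*x) * (exp (-K*x) * \<delta>) \<le> T y x" "T y x \<le> exp (K*x) * (exp (-K*x) * k)"
      unfolding T_def bound_int by (auto intro: mult_left_mono)
    moreover have "exp (K*x) * exp (-K*x) = 1" by (simp flip: exp_add)
    ultimately show ?thesis by (simp add: mult.assoc[symmetric])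
  qed
  define good where "good = (\<lambda>y::real \<Rightarrow> real. continuous_on UNIV y \<and> (\<forall>x. y x \<in> {\<delta>..k}))"
  have w_int: "w y integrable_on {x..}" if "good y" for y x
    using exp_weight_integrable[OF K, of "\<lambda>t. H t (y t)" "K*k" x] HcontI[of y] Habs that
    unfolding w_def good_def by auto
  have T_cont: "continuous_on UNIV (T y)" if "\<And>x. w y integrable_on {x..}" for y
    unfolding T_def by (intro continuous_intros continuous_tail_integral that)
  have T_good: "good (T y)" if "good y" for y
    using T_cont[of y] range[of y] w_int[OF that] that by (auto simp: good_def)
  have T_mono: "T y1 x \<le> T y2 x" if "good y1" "good y2" "\<And>x. y1 x \<le> y2 x" for y1 y2 x
    unfolding T_def
    by (intro mult_left_mono integral_le w_int that) (use that in \<open>auto simp: w_def good_def intro!: Hmono\<close>)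
  define R where "R = (\<lambda>n. (T ^^ n) (\<lambda>_. k))"
  have R_Suc: "R (Suc n) = T (R n)" for n by (simp add: R_def)
  have R0: "R 0 = (\<lambda>_. k)" by (simp add: R_def)
  have R_good: "good (R n)" for n
    by (induction n) (auto simp: R_Suc R0 T_good, simp add: good_def ord)
  have R_dec: "R (Suc n) x \<le> R n x" for n x
  proof (induction n arbitrary: x)
    case 0
    then show ?case using R_good[of "Suc 0"] by (simp add: R0 good_def)
  next
    case (Suc n)
    have "T (R (Suc n)) x \<le> T (R n) x" by (intro T_mono R_good Suc)
    then show ?case by (simp add: R_Suc)
  qed
  have R_range: "R n x \<in> {\<delta>..k}" for n x using R_good by (auto simp: good_def)
  have "\<exists>L. (\<lambda>n. R n x) \<longlonglongrightarrow> L" for x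
  proof -
    have "decseq (\<lambda>n. R n x)" by (rule decseq_SucI) (rule R_dec)
    then show ?thesis using decseq_convergent[of "\<lambda>n. R n x" \<delta>] R_range by (metis atLeastAtMost_iff)
  qed
  then obtain y where lim: "\<And>x. (\<lambda>n. R n x) \<longlonglongrightarrow> y x" by metis
  have y_range: "y x \<in> {\<delta>..k}" for x
    using closed_sequentially[OF closed_atLeastAtMost R_range lim] .
  have w_lim: "(\<lambda>n. w (R n) t) \<longlonglongrightarrow> w y t" for t
  proof -
    have "continuous_on {\<delta>..k} (\<lambda>v. H t v)"
      using continuous_on_compose2[OF Hcont continuous_on_Pair[OF continuous_on_const continuous_on_id]]
      by (simp add: image_subset_iff)
    from continuous_on_tendsto_compose[OF this lim y_range] R_range
    have "(\<lambda>n. H t (R n t)) \<longlonglongrightarrow> H t (y t)" by simp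
    then show ?thesis unfolding w_def by (intro tendsto_intros)
  qed
  have w_le: "norm (w (R n) t) \<le> exp (-K*t) * (K * k)" for n t
    using Habs[OF R_range, of t n t] by (simp add: w_def abs_mult)
  note dom = dominated_convergence[OF w_int[OF R_good] bound_intble w_le w_lim]
  \<comment> \<open>The limit is only known to be a pointwise one; it is continuous, hence differentiable,
    because it is a value of \<open>T\<close>.\<close>
  have fix_y: "y = T y"
  proof
    fix x
    have "(\<lambda>n. R (Suc n) x) \<longlonglongrightarrow> T y x"
      unfolding R_Suc T_def by (intro tendsto_intros dom(2))
    then show "y x = T y x" using lim[THEN LIMSEQ_Suc] LIMSEQ_unique by blast
  qed
  have y_cont: "continuous_on UNIV y"
    using T_cont[OF dom(1)] fix_y by simp
  have w_cont: "continuous_on UNIV (w y)"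
    unfolding w_def by (intro continuous_intros HcontI y_cont y_range)
  have "(T y has_real_derivative \<Phi> x (y x)) (at x)" for x
  proof -
    have "(T y has_real_derivative K * exp (K*x) * integral {x..} (w y) + exp (K*x) * (- w y x)) (at x)"
      unfolding T_def
      by (rule derivative_eq_intros tail_integral_has_derivative dom(1) w_cont refl)+ simp
    moreover have "K * exp (K*x) * integral {x..} (w y) + exp (K*x) * (- w y x) = K * T y x - H x (y x)"
      by (simp add: T_def w_def exp_minus)
    ultimately show ?thesis using fix_y by (simp add: H_def)
  qed
  with fix_y y_range that show thesis by metis
qed

text \<open>Separation of variables: with \<open>Z' = 1 / v\<close>, the solution is the inverse function of \<open>Z\<close>. The upper
bound on \<open>v\<close> makes \<open>Z\<close> grow at least linearly in both directions, so it is onto.\<close>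

lemma entire_autonomous_solution:
  fixes v :: "real \<Rightarrow> real"
  assumes cont: "continuous_on UNIV v" and m: "0 < m" and low: "\<And>x. m \<le> v x" and up: "\<And>x. v x \<le> M"
  obtains X where "\<And>t. (X has_real_derivative v (X t)) (at t)"
    "filterlim X at_top at_top" "filterlim X at_bot at_bot"
proof -
  have vpos: "v x > 0" for x using low[of x] m by linarith
  have Mpos: "M > 0" using vpos[of 0] up[of 0] by linarith
  have vcont: "isCont v x" for x
    using cont by (simp add: continuous_on_eq_continuous_at)
  have "\<exists>Z. \<forall>x::real. -\<infinity> < ereal x \<longrightarrow> ereal x < \<infinity> \<longrightarrow> (Z has_vector_derivative inverse (v x)) (at x)"
    by (rule einterval_antiderivative)
       (use vpos in \<open>auto intro!: continuous_intros vcont simp: less_imp_neq[THEN not_sym]\<close>)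
  then obtain Z where Z: "(Z has_real_derivative inverse (v x)) (at x)" for x
    by (auto simp: has_real_derivative_iff_has_vector_derivative)
  have Zlow: "(y - x) / M \<le> Z y - Z x" if "x \<le> y" for x y
  proof -
    have "Z x - x / M \<le> Z y - y / M"
    proof (rule DERIV_nonneg_imp_nondecreasing[OF that])
      fix s
      have "((\<lambda>s. Z s - s / M) has_real_derivative inverse (v s) - 1 / M) (at s)"
        by (rule derivative_eq_intros Z refl | use Mpos in simp)+
      moreover have "0 \<le> inverse (v s) - 1 / M"
        using vpos[of s] up[of s] by (simp add: inverse_eq_divide frac_le)
      ultimately show "\<exists>d. ((\<lambda>s. Z s - s / M) has_real_derivative d) (at s) \<and> 0 \<le> d" by blast
    qed
    then show ?thesis by (simp add: diff_divide_distrib)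
  qed
  have Zcont: "isCont Z x" for x using Z DERIV_isCont by blast
  have Zmono: "Z x < Z y" if "x < y" for x y
    using Zlow[of x y] that Mpos divide_pos_pos[of "y - x" M] by linarith
  have Zsurj: "\<exists>x. Z x = t" for t
  proof -
    define r where "r = M * \<bar>t - Z 0\<bar>"
    have r: "0 \<le> r" "r / M = \<bar>t - Z 0\<bar>" using Mpos by (auto simp: r_def)
    have "Z (-r) \<le> t" "t \<le> Z r"
      using Zlow[of 0 r] Zlow[of "-r" 0] r by auto
    then show ?thesis using IVT[of Z "-r" t r] r Zcont by auto
  qed
  define X where "X = inv Z"
  have ZX: "Z (X t) = t" for t unfolding X_def using Zsurj by (metis f_inv_into_f rangeI)
  have XZ: "X (Z x) = x" for x using ZX[of "Z x"] Zmono by (metis linorder_neqE less_irrefl)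
  have Xcont: "isCont X t" for t
    using isCont_inverse_function[of 1 "X t" X Z] by (simp add: ZX XZ Zcont)
  have "(X has_real_derivative inverse (inverse (v (X t)))) (at t)" for t
    by (rule DERIV_inverse_function[of Z, OF Z _ _ _ ZX Xcont, of _ "t - 1" "t + 1"])
       (use vpos[of "X t"] in auto)
  then have 1: "(X has_real_derivative v (X t)) (at t)" for t by simp
  have Xmono: "X s \<le> X t" if "s \<le> t" for s t
    using Zmono[of "X t" "X s"] that by (force simp: ZX)
  have 2: "filterlim X at_top at_top"
    unfolding filterlim_at_top eventually_at_top_linorder using Xmono XZ by metis
  have 3: "filterlim X at_bot at_bot"
    unfolding filterlim_at_bot eventually_at_bot_linorder using Xmono XZ by metis
  show thesis using that 1 2 3 by blast
qed

text \<open>As time runs backwards from \<open>z1\<close>, a function that is nondecreasing wherever it is negative can only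
become more negative. It therefore never comes back to zero, and the hypothesis stays in force.\<close>

lemma negative_nondecreasing_barrier:
  fixes G G' :: "real \<Rightarrow> real"
  assumes deriv: "\<And>z. (G has_real_derivative G' z) (at z)"
    and barrier: "\<And>z. z \<le> z1 \<Longrightarrow> G z < 0 \<Longrightarrow> 0 \<le> G' z"
    and neg: "G z1 < 0" and le: "z \<le> z1"
  shows "G z \<le> G z1"
proof (rule ccontr)
  assume "\<not> G z \<le> G z1"
  then obtain v where v: "G z1 < v" "v < 0" "v \<le> G z"
    using neg by (cases "G z < 0") (auto intro: dense that[of "G z"] dest: dense)
  have cont: "continuous_on A G" for A
    using deriv DERIV_isCont by (blast intro: continuous_at_imp_continuous_on)
  \<comment> \<open>The last point before \<open>z1\<close> at which \<open>G\<close> reaches the intermediate level \<open>v\<close>; after it \<open>G\<close> is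
    negative, hence nondecreasing.\<close>
  define S where "S = {z..z1} \<inter> G -` {v..}"
  have "closed S" unfolding S_def
    by (intro continuous_closed_preimage cont) auto
  moreover have "bounded S"
    by (rule bounded_subset[of "{z..z1}"]) (auto simp: S_def)
  ultimately have "compact S" by (simp add: compact_eq_bounded_closed)
  have "z \<in> S" using v le by (auto simp: S_def)
  with \<open>compact S\<close> obtain x where x: "x \<in> S" "\<And>s. s \<in> S \<Longrightarrow> s \<le> x"
    using compact_attains_sup[of S] by blast
  have "G s < v" if "x < s" "s \<le> z1" for s using x(2)[of s] x(1) that by (force simp: S_def)
  have x_le: "x \<le> z1" "v \<le> G x" using x(1) by (auto simp: S_def)
  have "G x \<le> v"
  proof (rule ccontr)
    assume "\<not> G x \<le> v"
    then obtain s where s: "x \<le> s" "s \<le> z1" "G s = v"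
      using IVT2[of G z1 v x] v x_le deriv DERIV_isCont by (metis less_imp_le linorder_not_le)
    then have "s \<in> S" using x(1) by (simp add: S_def)
    with x(2)[of s] s have "s = x" by simp
    then show False using s(3) \<open>\<not> G x \<le> v\<close> by simp
  qed
  have "G x \<le> G z1"
  proof (rule DERIV_nonneg_imp_nondecreasing[OF x_le(1)])
    fix s assume s: "x \<le> s" "s \<le> z1"
    then have "G s < 0" using \<open>G x \<le> v\<close> v(2) \<open>\<And>s. x < s \<Longrightarrow> s \<le> z1 \<Longrightarrow> G s < v\<close>[of s] by (cases "x = s") force+
    then show "\<exists>d. (G has_real_derivative d) (at s) \<and> 0 \<le> d" using deriv barrier s by blast
  qed
  then show False using x_le v by linarith
qed

text \<open>The logistic function serves as a change of variable from the line to \<open>(0, 1)\<close>; the proof of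
existence parametrises the values of the front by it.\<close>

definition logistic :: "real \<Rightarrow> real" where
  "logistic x = 1 / (1 + exp (- x))"

lemma logistic_pos [simp]: "0 < logistic x" and logistic_less_1 [simp]: "logistic x < 1"
  by (auto simp: logistic_def add_pos_pos)

lemma has_derivative_logistic:
  "(logistic has_real_derivative logistic x * (1 - logistic x)) (at x)"
proof -
  have "1 + exp (-x) \<noteq> 0" using exp_gt_zero[of "-x"] by linarith
  then show ?thesis
    unfolding logistic_def[abs_def]
    by (auto intro!: derivative_eq_intros simp: field_simps power2_eq_square)
qed

lemma logistic_at_top: "(logistic \<longlongrightarrow> 1) at_top"
proof -
  have "((\<lambda>x. exp (- x)) \<longlongrightarrow> (0::real)) at_top"
    by (rule filterlim_compose[OF exp_at_bot filterlim_uminus_at_bot_at_top])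
  then have "((\<lambda>x. 1 / (1 + exp (- x))) \<longlongrightarrow> 1 / (1 + (0::real))) at_top"
    by (intro tendsto_intros) auto
  then show ?thesis by (simp add: logistic_def[abs_def])
qed

lemma logistic_at_bot: "(logistic \<longlongrightarrow> 0) at_bot"
proof -
  have "logistic = (\<lambda>x. exp x / (exp x + 1))"
  proof
    show "logistic x = exp x / (exp x + 1)" for x
      using exp_gt_zero[of x] by (simp add: logistic_def exp_minus divide_simps add_nonneg_eq_0_iff)
  qed
  moreover have "((\<lambda>x. exp x / (exp x + 1)) \<longlongrightarrow> 0 / (0 + (1::real))) at_bot"
    by (intro tendsto_intros exp_at_bot) auto
  ultimately show ?thesis by simp
qed

section \<open>Nonlinearities of solvable type\<close>

text \<open>A single member of the family: \<open>a\<close> and \<open>b\<close> are the values of \<open>A\<close> and \<open>B\<close> at one parameter, and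
\<open>h'\<close> is the derivative of \<open>h\<close>, which attains its maximum 1 at 0.\<close>

locale solvable_nonlinearity =
  fixes g h h' :: "real \<Rightarrow> real" and a b :: real
  assumes h_deriv: "u \<in> {0..1} \<Longrightarrow> (h has_real_derivative h' u) (at u within {0..1})"
    and h'_cont: "continuous_on {0..1} h'"
    and h_0: "h 0 = 0" and h_1: "h 1 = 0"
    and h_pos: "0 < u \<Longrightarrow> u < 1 \<Longrightarrow> 0 < h u"
    and h'_0: "h' 0 = 1" and h'_1: "h' 1 < 0"
    and h'_le: "u \<in> {0..1} \<Longrightarrow> h' u \<le> 1"
    and b_pos: "0 < b"
    and factor_pos: "u \<in> {0..1} \<Longrightarrow> 0 < a - b * h' u"
    and g_eq: "u \<in> {0..1} \<Longrightarrow> g u = h u * (a - b * h' u)"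
begin

lemma b_less_a: "b < a"
  using factor_pos[of 0] h'_0 by simp

lemma h_nonneg: "u \<in> {0..1} \<Longrightarrow> 0 \<le> h u"
  using h_pos[of u] h_0 h_1 by (cases "u = 0 \<or> u = 1") auto

lemma g_nonneg: "u \<in> {0..1} \<Longrightarrow> 0 \<le> g u"
  using h_nonneg factor_pos[of u] by (simp add: g_eq)

lemma h_cont: "continuous_on {0..1} h"
  using h_deriv by (meson DERIV_continuous_on)

lemma h_deriv_interior: "0 < u \<Longrightarrow> u < 1 \<Longrightarrow> (h has_real_derivative h' u) (at u)"
  using h_deriv[of u] at_within_interior[of u "{0..1}"] by simp

text \<open>The quotient extends to a positive continuous function on \<open>[0, 1]\<close>: its limits at the endpoints are
\<open>h' 0 = 1\<close> and \<open>- h' 1\<close>, both positive because the zeros of \<open>h\<close> are simple.\<close>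

lemma h_comparable_logistic_rate:
  obtains \<theta> \<Theta> where "0 < \<theta>" "\<And>u. 0 < u \<Longrightarrow> u < 1 \<Longrightarrow> \<theta> \<le> h u / (u * (1 - u))"
    "\<And>u. 0 < u \<Longrightarrow> u < 1 \<Longrightarrow> h u / (u * (1 - u)) \<le> \<Theta>"
proof -
  define q where "q = (\<lambda>u. if u = 0 then 1 else if u = 1 then - h' 1 else h u / (u * (1 - u)))"
  have "((\<lambda>u. h u / u) \<longlongrightarrow> 1) (at 0 within {0..1})"
    using h_deriv[of 0] by (simp add: has_field_derivative_iff h_0 h'_0)
  then have "((\<lambda>u. h u / u / (1 - u)) \<longlongrightarrow> 1 / (1 - 0)) (at 0 within {0..1})"
    by (intro tendsto_intros) auto
  then have "(q \<longlongrightarrow> 1 / (1 - 0)) (at 0 within {0..1})"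
    by (rule Lim_transform_within[where d = 1]) (auto simp: q_def)
  then have "(q \<longlongrightarrow> q 0) (at 0 within {0..1})" by (simp add: q_def)
  moreover have "((\<lambda>u. h u / (u - 1)) \<longlongrightarrow> h' 1) (at 1 within {0..1})"
    using h_deriv[of 1] by (simp add: has_field_derivative_iff h_1)
  then have "((\<lambda>u. - (h u / (u - 1)) / u) \<longlongrightarrow> - h' 1 / 1) (at 1 within {0..1})"
    by (intro tendsto_intros) auto
  then have "(q \<longlongrightarrow> - h' 1 / 1) (at 1 within {0..1})"
    by (rule Lim_transform_within[where d = 1])
       (auto simp: q_def divide_simps dist_real_def algebra_simps)
  then have "(q \<longlongrightarrow> q 1) (at 1 within {0..1})" by (simp add: q_def)
  moreover have "(q \<longlongrightarrow> q u) (at u within {0..1})" if "0 < u" "u < 1" for u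
  proof -
    have "((\<lambda>u. h u / (u * (1 - u))) \<longlongrightarrow> h u / (u * (1 - u))) (at u within {0..1})"
      using h_cont that by (intro tendsto_intros) (auto simp: continuous_on_def)
    then have "(q \<longlongrightarrow> h u / (u * (1 - u))) (at u within {0..1})"
      by (rule Lim_transform_within[where d = "min u (1 - u)"])
         (use that in \<open>auto simp: q_def dist_real_def\<close>)
    then show ?thesis using that by (simp add: q_def)
  qed
  ultimately have cont: "continuous_on {0..1} q"
    unfolding continuous_on_def by (metis atLeastAtMost_iff order_le_less)
  have pos: "0 < q u" if "u \<in> {0..1}" for u
    using that h_pos[of u] h'_1 by (auto simp: q_def)
  obtain u0 where u0: "u0 \<in> {0..1}" "\<And>u. u \<in> {0..1} \<Longrightarrow> q u0 \<le> q u"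
    using continuous_attains_inf[OF _ _ cont] by auto
  obtain u1 where u1: "\<And>u. u \<in> {0..1} \<Longrightarrow> q u \<le> q u1"
    using continuous_attains_sup[OF _ _ cont] by fastforce
  have "q u = h u / (u * (1 - u))" if "0 < u" "u < 1" for u using that by (auto simp: q_def)
  then show thesis
    using that[of "q u0" "q u1"] pos[OF u0(1)] u0(2) u1 by (metis atLeastAtMost_iff less_imp_le)
qed

section \<open>Existence of fronts\<close>

text \<open>Seek the front with \<open>- U' = r * h U\<close>, where \<open>r\<close> is a function of the value of \<open>U\<close>. The equation
\<open>U'' + c * U' + g U = 0\<close> becomes \<open>h * dr/du = c - (a - b * h') / r - r * h'\<close>, which turns into
\<open>dr/dx = \<Phi> x r\<close> on the line under \<open>u = logistic x\<close>. This equation has continuous coefficients and is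
Lipschitz in \<open>r\<close> away from zero, although \<open>g\<close> itself need not be Lipschitz. The hypothesis \<open>super\<close>
says that the constant \<open>k\<close> is an upper barrier; every sufficiently small positive constant is a
lower barrier, because \<open>a - b * h' u\<close> is bounded away from zero. The profile \<open>U\<close> is then recovered by
solving the autonomous equation for \<open>x\<close> as a function of \<open>z\<close>.\<close>

lemma front_exists:
  assumes c: "0 \<le> c" and k: "0 < k"
    and super: "\<And>u. u \<in> {0..1} \<Longrightarrow> (k\<^sup>2 - b) * h' u + a - c * k \<le> 0"
  shows "\<exists>U. monotone_front g c U"
proof -
  obtain \<theta> \<Theta> where \<theta>: "0 < \<theta>"
    and Qlow: "\<And>u. 0 < u \<Longrightarrow> u < 1 \<Longrightarrow> \<theta> \<le> h u / (u * (1 - u))"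
    and Qup: "\<And>u. 0 < u \<Longrightarrow> u < 1 \<Longrightarrow> h u / (u * (1 - u)) \<le> \<Theta>"
    using h_comparable_logistic_rate by blast
  define Q where "Q = (\<lambda>x. h (logistic x) / (logistic x * (1 - logistic x)))"
  have Q: "\<theta> \<le> Q x" "Q x \<le> \<Theta>" "0 < Q x" for x
    using Qlow[of "logistic x"] Qup[of "logistic x"] \<theta> by (auto simp: Q_def intro: less_le_trans)
  have hQ: "h (logistic x) = Q x * (logistic x * (1 - logistic x))" for x
    using less_imp_neq[OF logistic_pos[of x]] less_imp_neq[OF logistic_less_1[of x]]
    by (simp add: Q_def)
  define m where "m = a - b"
  have m: "0 < m" using b_less_a by (simp add: m_def)
  have unit: "logistic x \<in> {0..1}" for x by (simp add: less_imp_le)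
  obtain M where M: "0 < M" "\<And>u. u \<in> {0..1} \<Longrightarrow> \<bar>h' u\<bar> \<le> M"
  proof -
    have "bounded (h' ` {0..1})"
      by (intro compact_imp_bounded compact_continuous_image h'_cont) simp
    then show thesis using that unfolding bounded_pos by force
  qed
  define \<kappa> where "\<kappa> = (\<lambda>x. h' (logistic x))"
  have \<kappa>: "\<bar>\<kappa> x\<bar> \<le> M" "m \<le> a - b * \<kappa> x" "a - b * \<kappa> x \<le> a + b * M" for x
  proof -
    show "\<bar>\<kappa> x\<bar> \<le> M" using M(2)[OF unit] by (simp add: \<kappa>_def)
    then have "b * (- M) \<le> b * \<kappa> x" using b_pos by (intro mult_left_mono) auto
    then show "a - b * \<kappa> x \<le> a + b * M" by simp
    have "b * \<kappa> x \<le> b * 1" using b_pos h'_le[OF unit] unfolding \<kappa>_def by (intro mult_left_mono) auto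
    then show "m \<le> a - b * \<kappa> x" by (simp add: m_def)
  qed
  \<comment> \<open>Small enough that \<open>c * \<delta> + M * \<delta>\<^sup>2 \<le> m\<close>, which makes \<open>\<delta>\<close> a lower barrier.\<close>
  define \<delta> where "\<delta> = min k (min 1 (m / (c + M)))"
  have \<delta>: "0 < \<delta>" "\<delta> \<le> k" "\<delta> \<le> 1" "(c + M) * \<delta> \<le> m"
  proof -
    have "c + M > 0" using c M by linarith
    then show "0 < \<delta>" "\<delta> \<le> k" "\<delta> \<le> 1" using k m by (auto simp: \<delta>_def)
    have "\<delta> \<le> m / (c + M)" by (simp add: \<delta>_def)
    then show "(c + M) * \<delta> \<le> m" using \<open>c + M > 0\<close> by (simp add: pos_le_divide_eq mult.commute)
  qed
  have lcont: "continuous_on A logistic" for A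
    using has_derivative_logistic by (meson DERIV_isCont continuous_at_imp_continuous_on)
  have \<kappa>cont: "continuous_on A \<kappa>" for A
    unfolding \<kappa>_def by (rule continuous_on_compose2[OF h'_cont lcont]) (use unit in auto)
  have Qcont: "continuous_on A Q" for A
    unfolding Q_def
    by (intro continuous_intros lcont continuous_on_compose2[OF h_cont lcont])
       (use unit in \<open>auto simp: less_imp_neq[THEN not_sym]\<close>)
  define \<Phi> where "\<Phi> = (\<lambda>x r. (c - (a - b * \<kappa> x) / r - r * \<kappa> x) / Q x)"
  define K where "K = ((a + b * M) / \<delta>\<^sup>2 + M) / \<theta>"
  have abM: "0 < a + b * M" using b_less_a b_pos M(1) by (simp add: add_pos_pos)
  have K: "0 < K" unfolding K_def using abM \<delta> M \<theta> by (simp add: add_pos_pos)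
  obtain y where y: "\<And>x. y x \<in> {\<delta>..k}" and y': "\<And>x. (y has_real_derivative \<Phi> x (y x)) (at x)"
  proof (rule entire_solution_between_constants[OF K \<delta>(1,2), of \<Phi>])
    have "continuous_on (UNIV \<times> {\<delta>..k})
        (\<lambda>z. (c - (a - b * \<kappa> (fst z)) / snd z - snd z * \<kappa> (fst z)) / Q (fst z))"
      by (intro continuous_intros continuous_on_compose2[OF \<kappa>cont[of UNIV]]
            continuous_on_compose2[OF Qcont[of UNIV]])
         (use \<delta>(1) Q(3) in \<open>auto simp: less_imp_neq[THEN not_sym]\<close>)
    then show "continuous_on (UNIV \<times> {\<delta>..k}) (\<lambda>(x, y). \<Phi> x y)"
      by (simp add: \<Phi>_def case_prod_unfold)
  next
    fix x
    have "c * \<delta> - \<delta> * \<delta> * \<kappa> x \<le> c * \<delta> + \<delta> * 1 * M"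
    proof -
      have "\<delta> * \<delta> * (- \<kappa> x) \<le> \<delta> * \<delta> * M" using \<delta> \<kappa>(1)[of x] by (intro mult_left_mono) auto
      also have "\<dots> \<le> \<delta> * 1 * M" using \<delta> M(1) by (intro mult_mono) auto
      finally have "\<delta> * \<delta> * (- \<kappa> x) \<le> \<delta> * 1 * M" .
      then show ?thesis by simp
    qed
    also have "\<dots> \<le> a - b * \<kappa> x" using \<delta>(4) \<kappa>(2)[of x] by (simp add: algebra_simps)
    finally have "c - (a - b * \<kappa> x) / \<delta> - \<delta> * \<kappa> x \<le> 0"
      using \<delta>(1) by (simp add: field_simps)
    then show "\<Phi> x \<delta> \<le> 0" using Q(3)[of x] by (simp add: \<Phi>_def divide_nonpos_pos)
  next
    fix x
    have "0 \<le> c - (a - b * \<kappa> x) / k - k * \<kappa> x"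
      using super[OF unit, of x] k by (simp add: \<kappa>_def field_simps power2_eq_square)
    then show "0 \<le> \<Phi> x k" using Q(3)[of x] by (simp add: \<Phi>_def)
  next
    fix x y1 y2 assume le: "\<delta> \<le> y1" "y1 \<le> y2" "y2 \<le> k"
    then have pos: "0 < y1" "0 < y2" using \<delta>(1) by auto
    have "\<delta>\<^sup>2 \<le> y1 * y2" unfolding power2_eq_square using le \<delta>(1) by (intro mult_mono) auto
    then have "(a - b * \<kappa> x) / (y1 * y2) \<le> (a + b * M) / \<delta>\<^sup>2"
      using \<kappa>(3)[of x] \<delta>(1) abM by (intro frac_le) auto
    then have rate: "(a - b * \<kappa> x) / (y1 * y2) - \<kappa> x \<le> (a + b * M) / \<delta>\<^sup>2 + M"
      using \<kappa>(1)[of x] by linarith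
    have "\<Phi> x y2 - \<Phi> x y1 = ((a - b * \<kappa> x) / (y1 * y2) - \<kappa> x) * (y2 - y1) / Q x"
      using pos Q(3)[of x] by (simp add: \<Phi>_def field_simps)
    also have "\<dots> \<le> ((a + b * M) / \<delta>\<^sup>2 + M) * (y2 - y1) / \<theta>"
    proof (rule frac_le)
      show "0 \<le> ((a + b * M) / \<delta>\<^sup>2 + M) * (y2 - y1)" using abM M(1) le(2) by simp
      show "((a - b * \<kappa> x) / (y1 * y2) - \<kappa> x) * (y2 - y1) \<le> ((a + b * M) / \<delta>\<^sup>2 + M) * (y2 - y1)"
        using rate le(2) by (intro mult_right_mono) auto
    qed (use \<theta> Q in auto)
    finally show "\<Phi> x y2 - \<Phi> x y1 \<le> K * (y2 - y1)" by (simp add: K_def)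
  qed blast
  have ycont: "continuous_on A y" for A
    using y' by (meson DERIV_isCont continuous_at_imp_continuous_on)
  have ypos: "0 < y x" for x using y[of x] \<delta>(1) by auto
  obtain X where X: "\<And>t. (X has_real_derivative y (X t) * Q (X t)) (at t)"
    and X_top: "filterlim X at_top at_top" and X_bot: "filterlim X at_bot at_bot"
  proof (rule entire_autonomous_solution[of "\<lambda>x. y x * Q x" "\<delta> * \<theta>" "k * \<Theta>"])
    show "continuous_on UNIV (\<lambda>x. y x * Q x)" by (intro continuous_intros ycont Qcont)
    show "0 < \<delta> * \<theta>" using \<delta> \<theta> by simp
    show "\<delta> * \<theta> \<le> y x * Q x" for x
      using y[of x] Q[of x] \<delta> \<theta> by (intro mult_mono) auto
    show "y x * Q x \<le> k * \<Theta>" for x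
      using y[of x] Q[of x] k by (intro mult_mono) auto
  qed blast
  \<comment> \<open>The front decreases, so \<open>x\<close> runs backwards along it.\<close>
  define Y where "Y = (\<lambda>z. X (- z))"
  have Y: "(Y has_real_derivative - (y (Y z) * Q (Y z))) (at z)" for z
    unfolding Y_def by (rule DERIV_cong[OF DERIV_chain2[OF X DERIV_minus[OF DERIV_ident]]]) simp
  define U where "U = (\<lambda>z. logistic (Y z))"
  have U01: "0 < U z" "U z < 1" for z by (auto simp: U_def)
  have U': "(U has_real_derivative - (y (Y z) * h (U z))) (at z)" for z
    unfolding U_def
    by (rule DERIV_cong[OF DERIV_chain2[OF has_derivative_logistic Y]]) (simp add: hQ)
  have U'': "((\<lambda>z. - (y (Y z) * h (U z))) has_real_derivative
      c * (y (Y z) * h (U z)) - g (U z)) (at z)" for z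
  proof -
    have *: "((\<lambda>z. y (Y z)) has_real_derivative \<Phi> (Y z) (y (Y z)) * - (y (Y z) * Q (Y z))) (at z)"
      by (rule DERIV_chain2[OF y' Y])
    have **: "((\<lambda>z. h (U z)) has_real_derivative h' (U z) * - (y (Y z) * h (U z))) (at z)"
      by (rule DERIV_chain2[OF h_deriv_interior[OF U01] U'])
    have \<kappa>U: "\<kappa> (Y z) = h' (U z)" by (simp add: \<kappa>_def U_def)
    have gU: "g (U z) = h (U z) * (a - b * h' (U z))"
      using U01[of z] by (intro g_eq) auto
    have "\<Phi> (Y z) (y (Y z)) * - (y (Y z) * Q (Y z))
        = - (c * y (Y z) - (a - b * h' (U z)) - (y (Y z))\<^sup>2 * h' (U z))"
      using Q(3)[of "Y z"] ypos[of "Y z"]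
      by (simp add: \<Phi>_def \<kappa>U field_simps power2_eq_square)
    from DERIV_minus[OF DERIV_mult[OF *[unfolded this] **]] show ?thesis
      by (rule DERIV_cong) (simp add: gU algebra_simps power2_eq_square)
  qed
  have "antimono U"
  proof (rule antimonoI)
    fix s t :: real assume "s \<le> t"
    then show "U t \<le> U s"
    proof (rule DERIV_nonpos_imp_nonincreasing)
      fix z
      have "- (y (Y z) * h (U z)) \<le> 0"
        using ypos[of "Y z"] h_pos[OF U01, of z] by simp
      then show "\<exists>d. (U has_real_derivative d) (at z) \<and> d \<le> 0" using U' by blast
    qed
  qed
  moreover have "(U \<longlongrightarrow> 1) at_bot" unfolding U_def Y_def
    by (rule filterlim_compose[OF logistic_at_top filterlim_compose[OF X_top filterlim_uminus_at_top_at_bot]])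
  moreover have "(U \<longlongrightarrow> 0) at_top" unfolding U_def Y_def
    by (rule filterlim_compose[OF logistic_at_bot filterlim_compose[OF X_bot filterlim_uminus_at_bot_at_top]])
  moreover have "\<forall>z. (U has_real_derivative - (y (Y z) * h (U z))) (at z) \<and>
      ((\<lambda>z. - (y (Y z) * h (U z))) has_real_derivative c * (y (Y z) * h (U z)) - g (U z)) (at z) \<and>
      c * (y (Y z) * h (U z)) - g (U z) + c * - (y (Y z) * h (U z)) + g (U z) = 0"
    using U' U'' by simp
  ultimately have "monotone_front g c U"
    unfolding monotone_front_def
    by (intro conjI exI[of _ "\<lambda>z. - (y (Y z) * h (U z))"]
          exI[of _ "\<lambda>z. c * (y (Y z) * h (U z)) - g (U z)"]) auto
  then show ?thesis by blast
qed

section \<open>Nonexistence of slower fronts\<close>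

text \<open>The bound \<open>V \<le> c * U\<close> holds because \<open>V - c * U\<close> has derivative \<open>g U \<ge> 0\<close>: once positive, it would
keep \<open>- U'\<close> bounded away from zero and drive \<open>U\<close> below 0. Positivity of \<open>U\<close> replaces a uniqueness
theorem for the zero solution: if \<open>U\<close> vanishes at \<open>z\<close>, then \<open>V\<close> vanishes there by that bound, and at
all earlier points because \<open>exp (c * z) * V z\<close> is nondecreasing; then \<open>U\<close> would vanish at all earlier points instead of tending to 1.\<close>

lemma front_nonincreasing_solution:
  assumes front: "monotone_front g c U" and c: "0 \<le> c"
  obtains V where "\<And>z. (U has_real_derivative - V z) (at z)"
    "\<And>z. (V has_real_derivative - c * V z + h (U z) * (a - b * h' (U z))) (at z)"
    "\<And>z. 0 < U z" "\<And>z. U z \<le> 1" "\<And>z. 0 \<le> V z" "\<And>z. V z \<le> c * U z"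
proof -
  obtain U' U'' where U': "\<And>z. (U has_real_derivative U' z) (at z)"
    and U'': "\<And>z. (U' has_real_derivative U'' z) (at z)"
    and ode: "\<And>z. U'' z + c * U' z + g (U z) = 0"
    and mon: "mono U \<or> antimono U" and lims: "(U \<longlongrightarrow> 1) at_bot" "(U \<longlongrightarrow> 0) at_top"
    using front unfolding monotone_front_def by blast
  have anti: "antimono U"
  proof (rule ccontr)
    assume "\<not> antimono U"
    with mon have "mono U" by blast
    have "1 \<le> U 0"
      by (rule tendsto_upperbound[OF lims(1)])
         (auto simp: eventually_at_bot_linorder intro: exI[of _ 0] monoD[OF \<open>mono U\<close>])
    moreover have "U 0 \<le> 0"
      by (rule tendsto_lowerbound[OF lims(2)])
         (auto simp: eventually_at_top_linorder intro: exI[of _ 0] monoD[OF \<open>mono U\<close>])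
    ultimately show False by simp
  qed
  have U_le: "U z \<le> 1" for z
    by (rule tendsto_lowerbound[OF lims(1)])
       (auto simp: eventually_at_bot_linorder intro: exI[of _ z] antimonoD[OF anti])
  have U_ge: "0 \<le> U z" for z
    by (rule tendsto_upperbound[OF lims(2)])
       (auto simp: eventually_at_top_linorder intro: exI[of _ z] antimonoD[OF anti])
  define V where "V = (\<lambda>z. - U' z)"
  have dU: "(U has_real_derivative - V z) (at z)" for z using U' by (simp add: V_def)
  have dV: "(V has_real_derivative - c * V z + g (U z)) (at z)" for z
    unfolding V_def using ode[of z] by (intro DERIV_cong[OF DERIV_minus[OF U'']]) simp
  have g0: "0 \<le> g (U z)" for z using U_le U_ge by (intro g_nonneg) auto
  have V_ge: "0 \<le> V z" for z
  proof -
    have "mono_on UNIV (\<lambda>z. - U z)" using anti by (auto simp: mono_on_def antimono_def)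
    moreover have "((\<lambda>z. - U z) has_real_derivative V z) (at z)"
      using DERIV_minus[OF dU] by simp
    ultimately show ?thesis using mono_on_imp_deriv_nonneg[of UNIV "\<lambda>z. - U z" "V z" z] by simp
  qed
  have V_le: "V z \<le> c * U z" for z
  proof (rule ccontr)
    assume "\<not> V z \<le> c * U z"
    define d where "d = V z - c * U z"
    have d: "0 < d" using \<open>\<not> V z \<le> c * U z\<close> by (simp add: d_def)
    have ge: "d \<le> V s" if "z \<le> s" for s
    proof -
      have "d \<le> V s - c * U s" unfolding d_def
      proof (rule DERIV_nonneg_imp_nondecreasing[OF that])
        fix t
        have "((\<lambda>t. V t - c * U t) has_real_derivative g (U t)) (at t)"
          by (rule derivative_eq_intros dU dV refl)+ simp
        with g0 show "\<exists>D. ((\<lambda>t. V t - c * U t) has_real_derivative D) (at t) \<and> 0 \<le> D" by blast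
      qed
      moreover have "0 \<le> c * U s" using c U_ge by simp
      ultimately show ?thesis by linarith
    qed
    have "U (z + 2 / d) + d * (z + 2 / d) \<le> U z + d * z"
    proof (rule DERIV_nonpos_imp_nonincreasing[where f = "\<lambda>t. U t + d * t"])
      show "z \<le> z + 2 / d" using d by simp
      fix t assume "z \<le> t"
      have "((\<lambda>t. U t + d * t) has_real_derivative - V t + d) (at t)"
        by (rule derivative_eq_intros dU refl)+ simp
      with ge[OF \<open>z \<le> t\<close>] show "\<exists>D. ((\<lambda>t. U t + d * t) has_real_derivative D) (at t) \<and> D \<le> 0"
        by (metis add.commute add_uminus_conv_diff diff_le_0_iff_le)
    qed
    then have "U (z + 2 / d) \<le> U z - 2" using d by (simp add: algebra_simps)
    then show False using U_ge[of "z + 2 / d"] U_le[of z] by linarith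
  qed
  have U_pos: "0 < U z" for z
  proof (rule ccontr)
    assume "\<not> 0 < U z"
    then have "U z = 0" using U_ge[of z] by simp
    then have "V z = 0" using V_le[of z] V_ge[of z] by simp
    have V0: "V s = 0" if "s \<le> z" for s
    proof -
      have "exp (c * s) * V s \<le> exp (c * z) * V z"
      proof (rule DERIV_nonneg_imp_nondecreasing[OF that])
        fix t
        have "((\<lambda>t. exp (c * t) * V t) has_real_derivative exp (c * t) * g (U t)) (at t)"
          by (rule derivative_eq_intros dV refl)+ (simp add: algebra_simps)
        moreover have "0 \<le> exp (c * t) * g (U t)" using g0 by simp
        ultimately show "\<exists>D. ((\<lambda>t. exp (c * t) * V t) has_real_derivative D) (at t) \<and> 0 \<le> D" by blast
      qed
      then show ?thesis using V_ge[of s] \<open>V z = 0\<close> by (simp add: mult_le_0_iff)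
    qed
    have "U s \<le> 0" if "s \<le> z" for s
    proof -
      have "U s \<le> U z"
      proof (rule DERIV_nonneg_imp_nondecreasing[OF that])
        fix t assume "t \<le> z"
        then show "\<exists>D. (U has_real_derivative D) (at t) \<and> 0 \<le> D" using dU[of t] V0[of t] by force
      qed
      then show ?thesis using \<open>U z = 0\<close> by simp
    qed
    then have "1 \<le> (0::real)"
      by (intro tendsto_upperbound[OF lims(1)]) (auto simp: eventually_at_bot_linorder)
    then show False by simp
  qed
  show thesis
    using that[of V] dU dV U_pos U_le V_ge V_le g_eq U_ge by simp
qed

text \<open>The ratio \<open>R = V / h U\<close> satisfies \<open>R' = h' U * R\<^sup>2 - c * R + (a - b * h' U)\<close>. As \<open>U\<close> tends to 0, \<open>h' U\<close>
tends to 1 and the right-hand side approaches the characteristic polynomial of the linearisation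
at 0, evaluated at \<open>R\<close>. If that polynomial is at least \<open>\<eta> > 0\<close> on the range of \<open>R\<close>, then \<open>R\<close> grows at
least linearly, whereas \<open>V \<le> c * U\<close> keeps it bounded.\<close>

lemma no_front_above_slope:
  assumes front: "monotone_front g c U" and c: "0 \<le> c" and \<rho>: "0 \<le> \<rho>" and \<eta>: "0 < \<eta>"
    and char: "\<And>r. \<rho> \<le> r \<Longrightarrow> \<eta> \<le> r\<^sup>2 - c * r + (a - b)"
    and dU: "\<And>z. (U has_real_derivative - V z) (at z)"
    and dV: "\<And>z. (V has_real_derivative - c * V z + h (U z) * (a - b * h' (U z))) (at z)"
    and U_pos: "\<And>z. 0 < U z" and V_le: "\<And>z. V z \<le> c * U z"
    and slope: "\<And>z. \<rho> * h (U z) \<le> V z"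
  shows False
proof -
  have lim: "(U \<longlongrightarrow> 0) at_top" using front by (simp add: monotone_front_def)
  have "((\<lambda>u. h u / u) \<longlongrightarrow> 1) (at 0 within {0..1})"
    using h_deriv[of 0] by (simp add: has_field_derivative_iff h_0 h'_0)
  from order_tendstoD(1)[OF this, of "1/2"]
  have ev1: "\<forall>\<^sub>F u in at 0 within {0..1}. 1 / 2 < h u / u" by simp
  have "(h' \<longlongrightarrow> 1) (at 0 within {0..1})"
    using h'_cont unfolding continuous_on_def by (simp flip: h'_0)
  then have "((\<lambda>u. (1 - h' u) * (4 * c\<^sup>2)) \<longlongrightarrow> (1 - 1) * (4 * c\<^sup>2)) (at 0 within {0..1})"
    by (intro tendsto_intros)
  from order_tendstoD(2)[OF this, of "\<eta> / 2"] \<eta>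
  have ev2: "\<forall>\<^sub>F u in at 0 within {0..1}. (1 - h' u) * (4 * c\<^sup>2) < \<eta> / 2" by simp
  \<comment> \<open>For \<open>0 < U < d\<close> the ratio is at most \<open>2 * c\<close>, so replacing \<open>h' U\<close> by 1 in the equation for \<open>R\<close>
    raises its right-hand side by at most \<open>\<eta> / 2\<close>.\<close>
  obtain d where d: "0 < d"
    and near: "\<And>u. u \<in> {0..1} \<Longrightarrow> u \<noteq> 0 \<Longrightarrow> dist u 0 < d \<Longrightarrow>
      1 / 2 < h u / u \<and> (1 - h' u) * (4 * c\<^sup>2) < \<eta> / 2"
    using eventually_conj[OF ev1 ev2] unfolding eventually_at by blast
  have "\<forall>\<^sub>F z in at_top. U z < min d 1"
    using order_tendstoD(2)[OF lim, of "min d 1"] d by simp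
  then obtain z0 where z0: "\<And>z. z0 \<le> z \<Longrightarrow> U z < min d 1"
    unfolding eventually_at_top_linorder by blast
  define R where "R = (\<lambda>z. V z / h (U z))"
  have loc0: "0 < h (U z)" "U z \<le> 2 * h (U z)" "(1 - h' (U z)) * (4 * c\<^sup>2) < \<eta> / 2"
    "0 < U z" "U z < 1" "h' (U z) \<le> 1" if "z0 \<le> z" for z
  proof -
    show U: "0 < U z" "U z < 1" using U_pos z0[OF that] by auto
    have "1 / 2 < h (U z) / U z \<and> (1 - h' (U z)) * (4 * c\<^sup>2) < \<eta> / 2"
      by (rule near) (use U z0[OF that] in \<open>auto simp: dist_real_def\<close>)
    then show "U z \<le> 2 * h (U z)" "(1 - h' (U z)) * (4 * c\<^sup>2) < \<eta> / 2"
      using U(1) by (auto simp: field_simps)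
    show "0 < h (U z)" "h' (U z) \<le> 1" using U h_pos h'_le by auto
  qed
  have R: "\<rho> \<le> R z" "R z \<le> 2 * c" if "z0 \<le> z" for z
  proof -
    show "\<rho> \<le> R z" using slope[of z] loc0(1)[OF that] by (simp add: R_def pos_le_divide_eq)
    have "V z \<le> c * (2 * h (U z))"
      using V_le[of z] mult_left_mono[OF loc0(2)[OF that] c] by linarith
    then show "R z \<le> 2 * c" using loc0(1)[OF that] by (simp add: R_def pos_divide_le_eq)
  qed
  have growth: "R z0 - \<eta> / 2 * z0 \<le> R z - \<eta> / 2 * z" if "z0 \<le> z" for z
  proof (rule DERIV_nonneg_imp_nondecreasing[OF that])
    fix t assume t: "z0 \<le> t"
    let ?k = "h' (U t)"
    note loc = loc0[OF t]
    have dh: "((\<lambda>z. h (U z)) has_real_derivative ?k * - V t) (at t)"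
      by (rule DERIV_chain2[OF h_deriv_interior[OF loc(4,5)] dU])
    have "(R has_real_derivative ?k * (R t)\<^sup>2 - c * R t + (a - b * ?k)) (at t)"
      unfolding R_def
      by (rule DERIV_cong[OF DERIV_divide[OF dV dh]])
         (use loc(1) in \<open>auto simp: field_simps power2_eq_square\<close>)
    then have "((\<lambda>z. R z - \<eta> / 2 * z) has_real_derivative
        ?k * (R t)\<^sup>2 - c * R t + (a - b * ?k) - \<eta> / 2) (at t)"
      by (auto intro!: derivative_eq_intros)
    moreover have "0 \<le> ?k * (R t)\<^sup>2 - c * R t + (a - b * ?k) - \<eta> / 2"
    proof -
      have "(R t)\<^sup>2 \<le> (2 * c)\<^sup>2" using R[OF t] \<rho> by (intro power_mono) auto
      then have "(1 - ?k) * (R t)\<^sup>2 \<le> (1 - ?k) * (4 * c\<^sup>2)"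
        using loc(6) by (intro mult_left_mono) (auto simp: power_mult_distrib)
      moreover have "0 \<le> b * (1 - ?k)" using b_pos loc(6) by simp
      moreover have "?k * (R t)\<^sup>2 - c * R t + (a - b * ?k)
          = ((R t)\<^sup>2 - c * R t + (a - b)) - (1 - ?k) * (R t)\<^sup>2 + b * (1 - ?k)"
        by (simp add: algebra_simps)
      ultimately show ?thesis using char[OF R(1)[OF t]] loc(3) by linarith
    qed
    ultimately show "\<exists>D. ((\<lambda>z. R z - \<eta> / 2 * z) has_real_derivative D) (at t) \<and> 0 \<le> D" by blast
  qed
  define s where "s = 2 * (2 * c + 1) / \<eta>"
  have s: "0 \<le> s" "\<eta> / 2 * s = 2 * c + 1" using \<eta> c by (auto simp: s_def)
  have "R z0 + (2 * c + 1) \<le> R (z0 + s)"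
    using growth[of "z0 + s"] s by (simp only: distrib_left) linarith
  then show False using R(1)[of z0] R(2)[of "z0 + s"] \<rho> s(1) by simp
qed

text \<open>Below the linear speed the characteristic polynomial has no real root, so it is positive for all
slopes.\<close>

lemma no_front_below_linear_speed:
  assumes c: "0 \<le> c" "c < 2 * sqrt (a - b)"
  shows "\<not> monotone_front g c U"
proof
  assume front: "monotone_front g c U"
  from front_nonincreasing_solution[OF front c(1)] obtain V
    where V: "\<And>z. (U has_real_derivative - V z) (at z)"
    "\<And>z. (V has_real_derivative - c * V z + h (U z) * (a - b * h' (U z))) (at z)"
    "\<And>z. 0 < U z" "\<And>z. U z \<le> 1" "\<And>z. 0 \<le> V z" "\<And>z. V z \<le> c * U z" by blast
  have "c\<^sup>2 < (2 * sqrt (a - b))\<^sup>2" using c by (intro power_strict_mono) auto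
  then have pos: "0 < (a - b) - c\<^sup>2 / 4" using b_less_a by (simp add: power_mult_distrib)
  have "(a - b) - c\<^sup>2 / 4 \<le> r\<^sup>2 - c * r + (a - b)" for r
    using zero_le_power2[of "r - c / 2"] by (simp add: power2_diff power_divide mult.commute)
  from no_front_above_slope[OF front c(1) order_refl pos this V(1,2,3,6)] V(5)
  show False by simp
qed

text \<open>The curve \<open>- U' = sqrt b * h U\<close> is the explicit front of speed \<open>a / sqrt b\<close>. A slower front has to stay
above this curve in the phase plane, since both emanate from \<open>U = 1\<close>. When \<open>a < 2 * b\<close>, however, \<open>sqrt b\<close> is
the larger characteristic root at speed \<open>a / sqrt b\<close>, so for a smaller \<open>c\<close> the characteristic
polynomial is positive on all slopes from \<open>sqrt b\<close> on.\<close>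

lemma no_front_below_nonlinear_speed:
  assumes c: "0 \<le> c" "c < a / sqrt b" and pushed: "a < 2 * b"
  shows "\<not> monotone_front g c U"
proof
  assume front: "monotone_front g c U"
  from front_nonincreasing_solution[OF front c(1)] obtain V
    where V: "\<And>z. (U has_real_derivative - V z) (at z)"
    "\<And>z. (V has_real_derivative - c * V z + h (U z) * (a - b * h' (U z))) (at z)"
    "\<And>z. 0 < U z" "\<And>z. U z \<le> 1" "\<And>z. 0 \<le> V z" "\<And>z. V z \<le> c * U z" by blast
  define q where "q = sqrt b"
  have q: "0 < q" "q * q = b" using b_pos by (auto simp: q_def)
  have cq: "c * q < a" using c(2) q by (simp add: q_def[symmetric] pos_less_divide_eq)
  then have "c * q < 2 * q * q" using pushed q(2) by simp
  then have c2q: "c \<le> 2 * q" using q(1) by simp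
  have U01: "U z \<in> {0..1}" for z using V(3,4) by (simp add: less_imp_le)
  have lim: "(U \<longlongrightarrow> 1) at_bot" using front by (simp add: monotone_front_def)
  define W where "W = (\<lambda>z. V z - q * h (U z))"
  have dh: "((\<lambda>z. h (U z)) has_real_derivative h' (U z) * - V z) (at z)" for z
  proof -
    have "(h has_real_derivative h' (U z)) (at (U z) within range U)"
      using h_deriv[OF U01] by (rule DERIV_subset) (use U01 in auto)
    from DERIV_image_chain[OF this V(1)] show ?thesis by (simp add: o_def)
  qed
  have dW: "(W has_real_derivative (q * h' (U z) - c) * W z + h (U z) * (a - c * q)) (at z)" for z
    unfolding W_def
    by (rule DERIV_cong[OF DERIV_diff[OF V(2) DERIV_cmult[OF dh]]])
       (simp add: q(2)[symmetric] algebra_simps)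
  have drive: "0 \<le> h (U z) * (a - c * q)" for z using h_nonneg[OF U01] cq by simp
  have "(h' \<longlongrightarrow> h' 1) (at 1 within {0..1})" using h'_cont by (auto simp: continuous_on_def)
  from order_tendstoD(2)[OF this h'_1]
  obtain d where d: "0 < d" "\<And>u. u \<in> {0..1} \<Longrightarrow> dist u 1 < d \<Longrightarrow> h' u < 0"
    unfolding eventually_at using h'_1 by metis
  obtain z1 where z1: "\<And>z. z \<le> z1 \<Longrightarrow> h' (U z) < 0"
    using tendstoD[OF lim d(1)] d(2)[OF U01] unfolding eventually_at_bot_linorder by blast
  have hU: "((\<lambda>z. h (U z)) \<longlongrightarrow> 0) at_bot"
    using continuous_on_tendsto_compose[OF h_cont lim] U01 h_1 by (simp add: always_eventually)
  \<comment> \<open>Since \<open>h' 1 < 0\<close>, the coefficient of \<open>W\<close> is negative near minus infinity. A negative value of \<open>W\<close> there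
    would persist back to minus infinity, but \<open>W \<ge> - q * h U\<close> and the latter tends to 0.\<close>
  have W_left: "0 \<le> W z" if "z \<le> z1" for z
  proof (rule ccontr)
    assume "\<not> 0 \<le> W z"
    have bar: "W s \<le> W z" if "s \<le> z" for s
    proof (rule negative_nondecreasing_barrier[OF dW _ _ that])
      fix t assume "t \<le> z" "W t < 0"
      then have "0 \<le> (q * h' (U t) - c) * W t"
        using z1[of t] \<open>z \<le> z1\<close> q(1) c(1) mult_pos_neg[OF q(1), of "h' (U t)"]
        by (intro mult_nonpos_nonpos) auto
      then show "0 \<le> (q * h' (U t) - c) * W t + h (U t) * (a - c * q)" using drive[of t] by linarith
    qed (use \<open>\<not> 0 \<le> W z\<close> in simp)
    have "((\<lambda>z. - (q * h (U z))) \<longlongrightarrow> - (q * 0)) at_bot" by (intro tendsto_intros hU)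
    then have "- (q * 0) \<le> W z"
    proof (rule tendsto_upperbound)
      have "- (q * h (U s)) \<le> W z" if "s \<le> z" for s
        using bar[OF that] V(5)[of s] by (simp add: W_def)
      then show "\<forall>\<^sub>F s in at_bot. - (q * h (U s)) \<le> W z"
        unfolding eventually_at_bot_linorder by blast
    qed simp
    then show False using \<open>\<not> 0 \<le> W z\<close> by simp
  qed
  have W_nonneg: "0 \<le> W z" for z
  proof (rule ccontr)
    assume neg: "\<not> 0 \<le> W z"
    \<comment> \<open>The coefficient of \<open>W\<close> is at most \<open>q\<close> as \<open>h' \<le> 1\<close>; the weight makes it nonpositive everywhere.\<close>
    define G where "G = (\<lambda>z. exp (- (q * z)) * W z)"
    have dG: "(G has_real_derivative exp (- (q * z)) *
        ((q * h' (U z) - c - q) * W z + h (U z) * (a - c * q))) (at z)" for z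
      unfolding G_def by (rule derivative_eq_intros dW refl)+ (simp add: algebra_simps)
    have "G (min z z1) \<le> G z"
    proof (rule negative_nondecreasing_barrier[OF dG])
      fix t assume "G t < 0"
      then have "W t < 0" by (simp add: G_def mult_less_0_iff)
      moreover have "q * h' (U t) - c - q \<le> 0"
        using mult_left_mono[of "h' (U t)" 1 q] h'_le[OF U01, of t] q(1) c(1) by linarith
      ultimately have "0 \<le> (q * h' (U t) - c - q) * W t" by (intro mult_nonpos_nonpos) auto
      then show "0 \<le> exp (- (q * t)) * ((q * h' (U t) - c - q) * W t + h (U t) * (a - c * q))"
        using drive[of t] by simp
    qed (use neg in \<open>auto simp: G_def mult_less_0_iff\<close>)
    moreover have "G z < 0" using neg by (simp add: G_def mult_less_0_iff)
    ultimately have "G (min z z1) < 0" by simp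
    then have "W (min z z1) < 0" by (simp add: G_def mult_less_0_iff)
    then show False using W_left[of "min z z1"] by simp
  qed
  have char: "q * (a / q - c) \<le> r\<^sup>2 - c * r + (a - b)" if "q \<le> r" for r
  proof -
    have "0 \<le> (r - q) * (r + q - c)" using that c2q by simp
    then show ?thesis using q by (simp add: algebra_simps power2_eq_square)
  qed
  have pos: "0 < q * (a / q - c)" using cq q by (simp add: algebra_simps)
  have slope: "q * h (U z) \<le> V z" for z using W_nonneg[of z] by (simp add: W_def)
  show False
    by (rule no_front_above_slope[OF front c(1) less_imp_le[OF q(1)] pos char V(1,2,3,6) slope])
qed

section \<open>The minimal speed\<close>

text \<open>The slope \<open>k = sqrt (a - b)\<close> is the double characteristic root at the linear speed. It is an upper
barrier for every larger speed because \<open>k\<^sup>2 \<ge> b\<close> allows \<open>h'\<close> to be replaced by its maximum 1.\<close>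

lemma linear_speed_minimal:
  assumes "2 * b \<le> a"
  shows "is_minimal_speed g (2 * sqrt (a - b))"
proof -
  let ?k = "sqrt (a - b)"
  have k: "0 < ?k" "?k\<^sup>2 = a - b" using b_less_a by auto
  have "\<exists>U. monotone_front g c U" if "2 * ?k \<le> c" for c
  proof (rule front_exists[OF _ k(1)])
    show "0 \<le> c" using that k(1) by linarith
    fix u :: real assume u: "u \<in> {0..1}"
    define X where "X = (?k\<^sup>2 - b) * h' u"
    have "X \<le> a - b - b" unfolding X_def
      using h'_le[OF u] assms k(2) mult_left_le[of "h' u" "?k\<^sup>2 - b"] by simp
    moreover have "2 * ?k * ?k \<le> c * ?k" using that k(1) by (intro mult_right_mono) auto
    then have "2 * ?k\<^sup>2 \<le> c * ?k" by (simp only: power2_eq_square mult.assoc)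
    ultimately have "X + a \<le> c * ?k" unfolding k(2) by argo
    then show "(?k\<^sup>2 - b) * h' u + a - c * ?k \<le> 0"
      unfolding X_def[symmetric] by simp
  qed
  moreover have "2 * ?k \<le> s" if "0 \<le> s" "\<forall>c\<ge>s. \<exists>U. monotone_front g c U" for s
    using that no_front_below_linear_speed[of s] by (meson linorder_not_le order_refl)
  ultimately show ?thesis using k(1) by (simp add: is_minimal_speed_def)
qed

text \<open>With \<open>k = sqrt b\<close>, the slope of the explicit front, the term in \<open>h'\<close> drops out of the barrier
condition, which reduces to \<open>c \<ge> a / sqrt b\<close>.\<close>

lemma nonlinear_speed_minimal:
  assumes "a < 2 * b"
  shows "is_minimal_speed g (a / sqrt b)"
proof -
  let ?q = "sqrt b"
  have q: "0 < ?q" "?q\<^sup>2 = b" using b_pos by auto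
  have pos: "0 < a / ?q" using b_less_a b_pos by simp
  have "\<exists>U. monotone_front g c U" if "a / ?q \<le> c" for c
  proof (rule front_exists[OF _ q(1)])
    show "0 \<le> c" using that pos by linarith
    show "(?q\<^sup>2 - b) * h' u + a - c * ?q \<le> 0" for u
      using that q by (simp add: pos_divide_le_eq)
  qed
  moreover have "a / ?q \<le> s" if "0 \<le> s" "\<forall>c\<ge>s. \<exists>U. monotone_front g c U" for s
    using that no_front_below_nonlinear_speed[of s, OF _ _ assms] by (meson linorder_not_le order_refl)
  ultimately show ?thesis using pos by (simp add: is_minimal_speed_def)
qed

end

section \<open>The minimality exchange\<close>

lemma unit_derivI:
  assumes "u \<in> {0..1}" "(f has_real_derivative D) (at u within {0..1})"
  shows "unit_deriv f u = D"
  using assms vector_derivative_within_closed_interval[of 0 1 u f D]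
  by (simp add: has_real_derivative_iff_has_vector_derivative)

text \<open>The factor \<open>k\<close> is only assumed continuous, so the product rule does not apply; the difference
quotient of the product at a zero of \<open>f\<close> is that of \<open>f\<close> times \<open>k\<close>.\<close>

lemma DERIV_mult_continuous_at_zero:
  fixes f k :: "real \<Rightarrow> real"
  assumes "(f has_real_derivative D) (at x within S)" and "f x = 0" and "continuous (at x within S) k"
  shows "((\<lambda>y. f y * k y) has_real_derivative D * k x) (at x within S)"
proof -
  have "((\<lambda>y. (f y - f x) / (y - x) * k y) \<longlongrightarrow> D * k x) (at x within S)"
    using assms by (intro tendsto_intros) (auto simp: has_field_derivative_iff continuous_within)
  then show ?thesis using assms(2) by (simp add: has_field_derivative_iff)
qed

lemma solvable_type_unit_deriv:
  assumes "solvable_type f h A B" and "u \<in> {0, 1}"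
  shows "unit_deriv (\<lambda>u. f u \<beta>) u = unit_deriv h u * (A \<beta> - B \<beta> * unit_deriv h u)"
proof (rule unit_derivI)
  show u: "u \<in> {0..1}" using assms(2) by auto
  have "(h has_real_derivative unit_deriv h u) (at u within {0..1})"
    using assms(1) u unfolding solvable_type_def differentiable_on_def
    by (metis has_real_derivative_iff_has_vector_derivative vector_derivative_works)
  moreover have "continuous (at u within {0..1}) (\<lambda>u. A \<beta> - B \<beta> * unit_deriv h u)"
    using assms(1) u unfolding solvable_type_def continuous_on_eq_continuous_within
    by (intro continuous_intros) auto
  ultimately have "((\<lambda>u. h u * (A \<beta> - B \<beta> * unit_deriv h u)) has_real_derivative
      unit_deriv h u * (A \<beta> - B \<beta> * unit_deriv h u)) (at u within {0..1})"
    using assms by (intro DERIV_mult_continuous_at_zero) (auto simp: solvable_type_def)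
  then show "((\<lambda>u. f u \<beta>) has_real_derivative
      unit_deriv h u * (A \<beta> - B \<beta> * unit_deriv h u)) (at u within {0..1})"
    by (rule has_field_derivative_transform_within[where d = 1])
       (use assms(1) u in \<open>auto simp: solvable_type_def\<close>)
qed

text \<open>Monostability supplies the two strict conditions that solvable type leaves open: \<open>h > 0\<close> inside the
interval, from \<open>f > 0\<close>, and \<open>unit_deriv h 1 < 0\<close>, from the sign of the derivative of \<open>f\<close> at 1.\<close>

lemma solvable_type_imp_solvable_nonlinearity:
  assumes mono: "monostable (\<lambda>u. f u \<beta>)" and solv: "solvable_type f h A B"
    and le: "\<forall>u\<in>{0..1}. unit_deriv h u \<le> 1"
  shows "solvable_nonlinearity (\<lambda>u. f u \<beta>) h (unit_deriv h) (A \<beta>) (B \<beta>)"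
proof
  note S = solv[unfolded solvable_type_def] and Mono = mono[unfolded monostable_def]
  show "(h has_real_derivative unit_deriv h u) (at u within {0..1})" if "u \<in> {0..1}" for u
    using S that unfolding differentiable_on_def
    by (metis has_real_derivative_iff_has_vector_derivative vector_derivative_works)
  show factor: "0 < A \<beta> - B \<beta> * unit_deriv h u" if "u \<in> {0..1}" for u
    using S that by blast
  show f_eq: "f u \<beta> = h u * (A \<beta> - B \<beta> * unit_deriv h u)" if "u \<in> {0..1}" for u
    using S that by blast
  show "0 < h u" if "0 < u" "u < 1" for u
  proof -
    have "0 < f u \<beta>" using Mono that by auto
    then have "0 < h u * (A \<beta> - B \<beta> * unit_deriv h u)" using f_eq[of u] that by simp
    moreover have "0 < A \<beta> - B \<beta> * unit_deriv h u" using that by (intro factor) auto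
    ultimately show ?thesis using zero_less_mult_pos2 by blast
  qed
  show "unit_deriv h 1 < 0"
    using Mono solvable_type_unit_deriv[OF solv, of 1 \<beta>] factor[of 1]
    by (auto simp: mult_less_0_iff)
qed (use solv le in \<open>auto simp: solvable_type_def\<close>)

lemma increasing_zero_changes_sign:
  fixes F :: "real \<Rightarrow> real"
  assumes "(F has_real_derivative d) (at x)" "0 < d" "F x = 0"
  shows "\<forall>\<^sub>F y in at_left x. F y < 0" "\<forall>\<^sub>F y in at_right x. 0 < F y"
proof -
  obtain r where r: "0 < r" "\<And>h. 0 < h \<Longrightarrow> h < r \<Longrightarrow> F x < F (x + h)"
    using DERIV_pos_inc_right[OF assms(1,2)] by blast
  obtain l where l: "0 < l" "\<And>h. 0 < h \<Longrightarrow> h < l \<Longrightarrow> F (x - h) < F x"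
    using DERIV_pos_inc_left[OF assms(1,2)] by blast
  have "F y < 0" if "x - l < y" "y < x" for y using l(2)[of "x - y"] that assms(3) by simp
  then show "\<forall>\<^sub>F y in at_left x. F y < 0"
    unfolding eventually_at_left_field using l(1) by (intro exI[of _ "x - l"]) auto
  have "0 < F y" if "x < y" "y < x + r" for y using r(2)[of "y - x"] that assms(3) by simp
  then show "\<forall>\<^sub>F y in at_right x. 0 < F y"
    unfolding eventually_at_right_field using r(1) by (intro exI[of _ "x + r"]) auto
qed

theorem theorem5:
  fixes f :: "real \<Rightarrow> real \<Rightarrow> real" and h A B :: "real \<Rightarrow> real" and \<beta>s :: real
  assumes "\<And>\<beta>. monostable (\<lambda>u. f u \<beta>)"
    and "solvable_type f h A B"
    and "nondegenerate_solution A B \<beta>s"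
    and "\<forall>u\<in>{0..1}. unit_deriv h u \<le> unit_deriv h 0" and "unit_deriv h 0 = 1"
  shows "minimality_exchange f A B \<beta>s"
proof -
  define lin where "lin = (\<lambda>\<beta>. is_minimal_speed (\<lambda>u. f u \<beta>) (linear_speed (\<lambda>u. f u \<beta>)))"
  define nonlin where "nonlin = (\<lambda>\<beta>. is_minimal_speed (\<lambda>u. f u \<beta>) (nonlinear_speed A B \<beta>))"
  have sol: "solvable_nonlinearity (\<lambda>u. f u \<beta>) h (unit_deriv h) (A \<beta>) (B \<beta>)" for \<beta>
    using solvable_type_imp_solvable_nonlinearity[of f \<beta> h A B] assms by simp
  have "linear_speed (\<lambda>u. f u \<beta>) = 2 * sqrt (A \<beta> - B \<beta>)" for \<beta>
    using solvable_type_unit_deriv[OF assms(2), of 0 \<beta>] assms(5) by (simp add: linear_speed_def)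
  then have pulled: "lin \<beta>" if "0 < A \<beta> - 2 * B \<beta>" for \<beta>
    using solvable_nonlinearity.linear_speed_minimal[OF sol, of \<beta>] that by (simp add: lin_def)
  have pushed: "nonlin \<beta>" if "A \<beta> - 2 * B \<beta> < 0" for \<beta>
    using solvable_nonlinearity.nonlinear_speed_minimal[OF sol, of \<beta>] that
    by (simp add: nonlin_def nonlinear_speed_def)
  obtain p q where p: "(A has_real_derivative p) (at \<beta>s)"
    and q: "((\<lambda>\<beta>. 2 * B \<beta>) has_real_derivative q) (at \<beta>s)" and pq: "p \<noteq> q"
    and zero: "A \<beta>s = 2 * B \<beta>s"
    using assms(3) unfolding nondegenerate_solution_def graphs_transverse_at_def by blast
  have d: "((\<lambda>\<beta>. A \<beta> - 2 * B \<beta>) has_real_derivative p - q) (at \<beta>s)"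
    by (rule DERIV_diff[OF p q])
  have d': "((\<lambda>\<beta>. 2 * B \<beta> - A \<beta>) has_real_derivative q - p) (at \<beta>s)"
    by (rule DERIV_diff[OF q p])
  have "(eventually lin (at_left \<beta>s) \<and> eventually nonlin (at_right \<beta>s)) \<or>
        (eventually nonlin (at_left \<beta>s) \<and> eventually lin (at_right \<beta>s))"
  proof (cases "q < p")
    case True
    have "eventually nonlin (at_left \<beta>s)" "eventually lin (at_right \<beta>s)"
      by (rule eventually_mono[OF increasing_zero_changes_sign(1)[OF d]];
          use True zero pushed in simp)
         (rule eventually_mono[OF increasing_zero_changes_sign(2)[OF d]];
          use True zero pulled in simp)
    then show ?thesis by blast
  next
    case False
    with pq have "p < q" by simp
    have "eventually lin (at_left \<beta>s)" "eventually nonlin (at_right \<beta>s)"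
      by (rule eventually_mono[OF increasing_zero_changes_sign(1)[OF d']];
          use \<open>p < q\<close> zero pulled in simp)
         (rule eventually_mono[OF increasing_zero_changes_sign(2)[OF d']];
          use \<open>p < q\<close> zero pushed in simp)
    then show ?thesis by blast
  qed
  then show ?thesis
    unfolding minimality_exchange_def lin_def nonlin_def Let_def .
qed

end
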